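(* Let $\mathcal{A}$ be a unital $C^*$-algebra, let $a\in\mathcal{A}$ be a positive and invertible element, let $\lambda\in[0,1]$ and let $x,y\in\mathcal{A}$. If $x\|_{a,\lambda}y$, then the following statements hold: 1) there exists $\mu\in\mathbb{T}$ such that $x\perp_{a,\lambda}\big(\|y\|_{a,\lambda}\,x-\mu\,\|x\|_{a,\lambda}\,y\big)$; 2) there exists $\mu\in\mathbb{T}$ such that $y\perp_{a,\lambda}\big(\|y\|_{a,\lambda}\,x-\overline{\mu}\,\|x\|_{a,\lambda}\,y\big)$.
   Context: $\mathbb{T}=\{z\in\mathbb{C} : |z|=1\}$. $\mathcal{S}_a(\mathcal{A})=\{\varphi\in\mathcal{A}' : \varphi\ge 0,\ \varphi(a)=1\}$, where $\mathcal{A}'$ is the topological dual of $\mathcal{A}$. For $x\in\mathcal{A}$, $\|x\|_{a,\lambda}=\sup\{\sqrt{\lambda\varphi(x^*ax)+(1-\lambda)|\varphi(ax)|^2} : \varphi\in\mathcal{S}_a(\mathcal{A})\}$. One writes $x\|_{a,\lambda}y$ ($(a,\lambda)$-norm parallelism) if there is $\mu\in\mathbb{T}$ with $\|x+\mu y\|_{a,\lambda}=\|x\|_{a,\lambda}+\|y\|_{a,\lambda}$, and $x\perp_{a,\lambda}y$ ($(a,\lambda)$-Birkhoff-James orthogonality) if $\|x+\xi y\|_{a,\lambda}\ge\|x\|_{a,\lambda}$ for all $\xi\in\mathbb{C}$. *)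

theory Defs
  imports Complex_Main "HOL-Library.Complex_Order"
begin

text \<open>
  Unital C*-algebras over the complex numbers. The class \<open>real_normed_algebra_1\<close> includes
  \<open>norm 1 = 1\<close>; in a unital C*-algebra this is equivalent to \<open>1 \<noteq> 0\<close>, so only the zero algebra
  is excluded.
\<close>

class unital_cstar_algebra = real_normed_algebra_1 + banach +
  fixes scaleC :: "complex \<Rightarrow> 'a \<Rightarrow> 'a"  (infixr "*\<^sub>C" 75)
    and star :: "'a \<Rightarrow> 'a"
  assumes scaleC_add_right: "c *\<^sub>C (x + y) = c *\<^sub>C x + c *\<^sub>C y"
    and scaleC_add_left: "(c + d) *\<^sub>C x = c *\<^sub>C x + d *\<^sub>C x"
    and scaleC_scaleC: "c *\<^sub>C (d *\<^sub>C x) = (c * d) *\<^sub>C x"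
    and scaleR_eq_scaleC: "r *\<^sub>R x = complex_of_real r *\<^sub>C x"
    and mult_scaleC_left: "(c *\<^sub>C x) * y = c *\<^sub>C (x * y)"
    and mult_scaleC_right: "x * (c *\<^sub>C y) = c *\<^sub>C (x * y)"
    and norm_scaleC: "norm (c *\<^sub>C x) = cmod c * norm x"
    and star_star: "star (star x) = x"
    and star_add: "star (x + y) = star x + star y"
    and star_scaleC: "star (c *\<^sub>C x) = cnj c *\<^sub>C star x"
    and star_mult: "star (x * y) = star y * star x"
    and norm_star_mult: "norm (star x * x) = (norm x)\<^sup>2"

instantiation complex :: unital_cstar_algebra
begin

definition scaleC_complex :: "complex \<Rightarrow> complex \<Rightarrow> complex"
  where "scaleC_complex c x = c * x"

definition star_complex :: "complex \<Rightarrow> complex"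
  where "star_complex = cnj"

instance
  by standard
    (auto simp: scaleC_complex_def star_complex_def algebra_simps scaleR_conv_of_real
      norm_mult power2_eq_square)

end

definition positive_elem :: "'a::unital_cstar_algebra \<Rightarrow> bool"
  where "positive_elem a \<longleftrightarrow> (\<exists>b. a = star b * b)"

definition invertible_elem :: "'a::unital_cstar_algebra \<Rightarrow> bool"
  where "invertible_elem a \<longleftrightarrow> (\<exists>b. a * b = 1 \<and> b * a = 1)"

definition dual_space :: "('a::unital_cstar_algebra \<Rightarrow> complex) set"
  where "dual_space = {\<phi>. bounded_linear \<phi> \<and> (\<forall>c x. \<phi> (c *\<^sub>C x) = c * \<phi> x)}"

text \<open>
  In the next definition \<open>0 \<le> z\<close> for complex \<open>z\<close> is the order of
  \<open>HOL-Library.Complex_Order\<close>: \<open>z\<close> is real and nonnegative.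
\<close>

definition positive_functional :: "('a::unital_cstar_algebra \<Rightarrow> complex) \<Rightarrow> bool"
  where "positive_functional \<phi> \<longleftrightarrow> (\<forall>x. positive_elem x \<longrightarrow> 0 \<le> \<phi> x)"

definition states_wrt :: "'a::unital_cstar_algebra \<Rightarrow> ('a \<Rightarrow> complex) set"
  where "states_wrt a = {\<phi> \<in> dual_space. positive_functional \<phi> \<and> \<phi> a = 1}"

text \<open>
  The real parameter \<open>t\<close> is the one usually written lambda.
  For positive \<open>a\<close> the number \<open>\<phi> (star x * a * x)\<close> is real and nonnegative, so taking its real
  part is only a coercion. The supremum is taken in the reals; for positive invertible \<open>a\<close>
  and \<open>t \<in> [0,1]\<close> the set is nonempty and bounded above.
\<close>

definition al_norm :: "'a::unital_cstar_algebra \<Rightarrow> real \<Rightarrow> 'a \<Rightarrow> real"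
  where "al_norm a t x =
    (SUP \<phi>\<in>states_wrt a. sqrt (t * Re (\<phi> (star x * a * x)) + (1 - t) * (cmod (\<phi> (a * x)))\<^sup>2))"

definition al_parallel :: "'a::unital_cstar_algebra \<Rightarrow> real \<Rightarrow> 'a \<Rightarrow> 'a \<Rightarrow> bool"
  where "al_parallel a t x y \<longleftrightarrow>
    (\<exists>\<mu>. cmod \<mu> = 1 \<and> al_norm a t (x + \<mu> *\<^sub>C y) = al_norm a t x + al_norm a t y)"

definition al_orthogonal :: "'a::unital_cstar_algebra \<Rightarrow> real \<Rightarrow> 'a \<Rightarrow> 'a \<Rightarrow> bool"
  where "al_orthogonal a t x y \<longleftrightarrow> (\<forall>\<xi>. al_norm a t (x + \<xi> *\<^sub>C y) \<ge> al_norm a t x)"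

end

theory Submission
  imports Defs
begin

text \<open>
  For a functional \<open>\<phi>\<close> in \<open>states_wrt a\<close> the expression under the supremum in \<open>al_norm\<close> is the
  seminorm of the positive semidefinite sesquilinear form
  \<open>(u, v) \<mapsto> t * \<phi> (star u * a * v) + (1 - t) * cnj (\<phi> (a * u)) * \<phi> (a * v)\<close>. Hence \<open>al_norm a t\<close>
  is a supremum of seminorms coming from semi-inner products, and the theorem holds for all such
  suprema \<open>N\<close> that are finite (\<open>sup_form_norm_orthogonal\<close>).

  Suppose \<open>N (x + y) = N x + N y\<close>, the unimodular scalar having been absorbed into \<open>y\<close>, and choose
  forms in the family whose seminorms of \<open>x + y\<close> tend to \<open>N x + N y\<close>. By the triangle inequality
  their seminorms of \<open>x\<close> and of \<open>y\<close> tend to \<open>N x\<close> and \<open>N y\<close>. The squared seminorm of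
  \<open>w = N y x - N x y\<close> is a polynomial in the seminorms of \<open>x\<close>, \<open>y\<close> and \<open>x + y\<close>
  (\<open>form_norm_combination\<close>), and it therefore tends to 0. So \<open>N (x + \<xi> w)\<close> is at least
  the limit \<open>N x\<close> of the seminorms of \<open>x\<close>, and the same argument applies to \<open>y\<close>.

  Finiteness of the supremum is where invertibility of \<open>a = star b * b\<close> enters: then
  \<open>b\<close> has a left inverse \<open>c\<close>, the functional \<open>w \<mapsto> \<phi> (star b * w * b)\<close> is an ordinary state, and
  \<open>\<phi> (star x * a * x)\<close> is its value at \<open>star z * z\<close> with \<open>z = b * x * c\<close>, which is at most
  \<open>(norm z)\<^sup>2\<close> (\<open>cmod_state_le_norm\<close>).
\<close>

section \<open>Semi-inner products\<close>

lemma scaleC_minus_one: "(-1) *\<^sub>C x = - (x::'a::unital_cstar_algebra)"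
  using scaleR_eq_scaleC[of "-1" x] by simp

lemma scaleC_one: "1 *\<^sub>C x = (x::'a::unital_cstar_algebra)"
  using scaleR_eq_scaleC[of 1 x] by simp

lemma scaleC_minus_left: "(- c) *\<^sub>C x = - (c *\<^sub>C (x::'a::unital_cstar_algebra))"
  using scaleC_scaleC[of "-1" c x] by (simp add: scaleC_minus_one)

lemma star_one: "star (1::'a::unital_cstar_algebra) = 1"
  using star_mult[of "star (1::'a)" 1] by (simp add: star_star)

text \<open>
  A positive semidefinite sesquilinear form, conjugate linear in the first argument. The order in
  \<open>nonneg\<close> is that of the complex numbers, so the diagonal values are in particular real.
\<close>

locale semi_inner_form =
  fixes q :: "'a::unital_cstar_algebra \<Rightarrow> 'a \<Rightarrow> complex"
  assumes add_left: "q (x + y) z = q x z + q y z"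
    and add_right: "q z (x + y) = q z x + q z y"
    and scale_left: "q (c *\<^sub>C x) y = cnj c * q x y"
    and scale_right: "q x (c *\<^sub>C y) = c * q x y"
    and nonneg: "0 \<le> q x x"

text \<open>The seminorm of a semi-inner product.\<close>

definition form_norm :: "('a::unital_cstar_algebra \<Rightarrow> 'a \<Rightarrow> complex) \<Rightarrow> 'a \<Rightarrow> real"
  where "form_norm q x = sqrt (Re (q x x))"

context semi_inner_form
begin

lemma Re_nonneg: "0 \<le> Re (q x x)"
  using nonneg[of x] by (simp add: less_eq_complex_def)

lemma Im_zero: "Im (q x x) = 0"
  using nonneg[of x] by (simp add: less_eq_complex_def)

lemma hermitian: "q y x = cnj (q x y)"
proof (rule complex_eqI)
  show "Im (q y x) = Im (cnj (q x y))"
    using Im_zero[of "x + y"] Im_zero[of x] Im_zero[of y] by (simp add: add_left add_right)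
  show "Re (q y x) = Re (cnj (q x y))"
    using Im_zero[of "x + \<i> *\<^sub>C y"] Im_zero[of x] Im_zero[of y]
    by (simp add: add_left add_right scale_left scale_right)
qed

lemma diag_add_scale:
  "Re (q (x + c *\<^sub>C y) (x + c *\<^sub>C y))
     = Re (q x x) + 2 * Re (c * q x y) + (cmod c)\<^sup>2 * Re (q y y)"
  unfolding cmod_power2
  by (simp add: add_left add_right scale_left scale_right hermitian[of y x] algebra_simps
      power2_eq_square Im_zero)

lemma cauchy_schwarz: "(cmod (q x y))\<^sup>2 \<le> Re (q x x) * Re (q y y)"
proof -
  define p where "p = (cmod (q x y))\<^sup>2"
  have quad: "0 \<le> Re (q x x) - 2 * s * p + s\<^sup>2 * p * Re (q y y)" for s :: real
  proof -
    have "Re (- (of_real s * cnj (q x y)) * q x y) = - s * p"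
      unfolding p_def cmod_power2 by (simp add: algebra_simps power2_eq_square)
    moreover have "(cmod (- (of_real s * cnj (q x y))))\<^sup>2 = s\<^sup>2 * p"
      by (simp add: p_def norm_mult power_mult_distrib)
    ultimately show ?thesis
      using diag_add_scale[of x "- (of_real s * cnj (q x y))" y]
        Re_nonneg[of "x + (- (of_real s * cnj (q x y))) *\<^sub>C y"] by simp
  qed
  show ?thesis
  proof (cases "Re (q y y) = 0")
    case True
    have "p = 0"
    proof (rule ccontr)
      assume "p \<noteq> 0"
      then have "0 < p" by (simp add: p_def)
      then show False
        using quad[of "(Re (q x x) + 1) / (2 * p)"] True Re_nonneg[of x] by simp
    qed
    then show ?thesis using True by (simp add: p_def)
  next
    case False
    then have pos: "0 < Re (q y y)" using Re_nonneg[of y] by simp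
    have "0 \<le> Re (q x x) - p / Re (q y y)"
      using quad[of "1 / Re (q y y)"] pos by (simp add: power2_eq_square)
    then show ?thesis using pos by (simp add: p_def field_simps)
  qed
qed

lemma form_norm_nonneg: "0 \<le> form_norm q x"
  by (simp add: form_norm_def Re_nonneg)

lemma form_norm_square: "(form_norm q x)\<^sup>2 = Re (q x x)"
  by (simp add: form_norm_def Re_nonneg)

lemma form_norm_scale: "form_norm q (c *\<^sub>C x) = cmod c * form_norm q x"
proof -
  have "Re (q (c *\<^sub>C x) (c *\<^sub>C x)) = (cmod c)\<^sup>2 * Re (q x x)"
    unfolding cmod_power2
    by (simp add: scale_left scale_right Im_zero algebra_simps power2_eq_square)
  then show ?thesis by (simp add: form_norm_def real_sqrt_mult)
qed

lemma form_norm_add: "form_norm q (x + y) \<le> form_norm q x + form_norm q y"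
proof (rule power2_le_imp_le)
  have "(cmod (q x y))\<^sup>2 \<le> (form_norm q x * form_norm q y)\<^sup>2"
    using cauchy_schwarz[of x y] by (simp add: power_mult_distrib form_norm_square)
  then have "cmod (q x y) \<le> form_norm q x * form_norm q y"
    by (rule power2_le_imp_le) (simp add: form_norm_nonneg)
  then have "Re (q x y) \<le> form_norm q x * form_norm q y"
    using complex_Re_le_cmod[of "q x y"] by linarith
  then show "(form_norm q (x + y))\<^sup>2 \<le> (form_norm q x + form_norm q y)\<^sup>2"
    using diag_add_scale[of x 1 y] by (simp add: power2_sum form_norm_square scaleC_one)
  show "0 \<le> form_norm q x + form_norm q y"
    by (simp add: form_norm_nonneg)
qed

lemma form_norm_add_ge: "form_norm q x - form_norm q y \<le> form_norm q (x + y)"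
  using form_norm_add[of "x + y" "(-1) *\<^sub>C y"] form_norm_scale[of "-1" y]
  by (simp add: scaleC_minus_one)

lemma form_norm_combination:
  fixes r s :: real
  shows "(form_norm q (of_real r *\<^sub>C x - of_real s *\<^sub>C y))\<^sup>2
    = r\<^sup>2 * (form_norm q x)\<^sup>2 + s\<^sup>2 * (form_norm q y)\<^sup>2
      - r * s * ((form_norm q (x + y))\<^sup>2 - (form_norm q x)\<^sup>2 - (form_norm q y)\<^sup>2)"
proof -
  have diff: "of_real r *\<^sub>C x - of_real s *\<^sub>C y = of_real r *\<^sub>C x + (- of_real s) *\<^sub>C y"
    by (simp add: scaleC_minus_left)
  show ?thesis
    unfolding form_norm_square diff
    by (simp add: add_left add_right scale_left scale_right hermitian[of y x] algebra_simps
        power2_eq_square)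
qed

end

section \<open>Suprema of semi-inner product seminorms\<close>

lemma sup_form_norm_orthogonal:
  fixes q :: "'i \<Rightarrow> 'a::unital_cstar_algebra \<Rightarrow> 'a \<Rightarrow> complex" and I :: "'i set"
  defines "N \<equiv> \<lambda>z. SUP i\<in>I. form_norm (q i) z"
  assumes form: "\<And>i. i \<in> I \<Longrightarrow> semi_inner_form (q i)"
    and ne: "I \<noteq> {}"
    and bdd: "\<And>z. bdd_above ((\<lambda>i. form_norm (q i) z) ` I)"
    and eq: "N (x + y) = N x + N y"
  shows "N x \<le> N (x + \<xi> *\<^sub>C (of_real (N y) *\<^sub>C x - of_real (N x) *\<^sub>C y))"
    and "N y \<le> N (y + \<xi> *\<^sub>C (of_real (N y) *\<^sub>C x - of_real (N x) *\<^sub>C y))"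
proof -
  have le_N: "form_norm (q i) z \<le> N z" if "i \<in> I" for i z
    unfolding N_def using bdd that by (rule cSUP_upper2) simp
  have "\<exists>i\<in>I. N (x + y) - 1 / real (Suc n) < form_norm (q i) (x + y)" for n
    using less_cSUP_iff[OF ne bdd[of "x + y"], of "N (x + y) - 1 / real (Suc n)"]
    by (simp add: N_def)
  then obtain k where k: "\<And>n. k n \<in> I"
    and k_gt: "\<And>n. N (x + y) - 1 / real (Suc n) < form_norm (q (k n)) (x + y)"
    by metis
  define f where "f n z = form_norm (q (k n)) z" for n z
  note kform = form[OF k]
  have f_le: "f n z \<le> N z" for n z
    unfolding f_def by (rule le_N[OF k])
  have f_add: "f n (u + v) \<le> f n u + f n v" for n u v
    unfolding f_def by (rule semi_inner_form.form_norm_add[OF kform])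
  have approx: "(\<lambda>n. c - 1 / real (Suc n)) \<longlonglongrightarrow> c" for c :: real
    using tendsto_diff[OF tendsto_const LIMSEQ_inverse_real_of_nat, of c]
    by (simp add: inverse_eq_divide)
  have lim_sum: "(\<lambda>n. f n (x + y)) \<longlonglongrightarrow> N x + N y"
    unfolding eq[symmetric]
  proof (rule tendsto_sandwich[OF _ _ approx tendsto_const])
    have "N (x + y) - 1 / real (Suc n) \<le> f n (x + y)" for n
      using k_gt[of n] unfolding f_def by linarith
    then show "\<forall>\<^sub>F n in sequentially. N (x + y) - 1 / real (Suc n) \<le> f n (x + y)" by simp
  qed (simp add: f_le)
  have lim_x: "(\<lambda>n. f n x) \<longlonglongrightarrow> N x"
  proof (rule tendsto_sandwich[OF _ _ approx tendsto_const])
    have "N x - 1 / real (Suc n) \<le> f n x" for n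
      using k_gt[of n] f_add[of n x y] f_le[of n y] eq unfolding f_def by linarith
    then show "\<forall>\<^sub>F n in sequentially. N x - 1 / real (Suc n) \<le> f n x" by simp
  qed (simp add: f_le)
  have lim_y: "(\<lambda>n. f n y) \<longlonglongrightarrow> N y"
  proof (rule tendsto_sandwich[OF _ _ approx tendsto_const])
    have "N y - 1 / real (Suc n) \<le> f n y" for n
      using k_gt[of n] f_add[of n x y] f_le[of n x] eq unfolding f_def by linarith
    then show "\<forall>\<^sub>F n in sequentially. N y - 1 / real (Suc n) \<le> f n y" by simp
  qed (simp add: f_le)
  define w where "w = of_real (N y) *\<^sub>C x - of_real (N x) *\<^sub>C y"
  have "(f n w)\<^sup>2 = (N y)\<^sup>2 * (f n x)\<^sup>2 + (N x)\<^sup>2 * (f n y)\<^sup>2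
      - N y * N x * ((f n (x + y))\<^sup>2 - (f n x)\<^sup>2 - (f n y)\<^sup>2)" for n
    unfolding f_def w_def by (rule semi_inner_form.form_norm_combination[OF kform])
  moreover have "(\<lambda>n. (N y)\<^sup>2 * (f n x)\<^sup>2 + (N x)\<^sup>2 * (f n y)\<^sup>2
      - N y * N x * ((f n (x + y))\<^sup>2 - (f n x)\<^sup>2 - (f n y)\<^sup>2))
    \<longlonglongrightarrow> (N y)\<^sup>2 * (N x)\<^sup>2 + (N x)\<^sup>2 * (N y)\<^sup>2
      - N y * N x * ((N x + N y)\<^sup>2 - (N x)\<^sup>2 - (N y)\<^sup>2)"
    by (intro tendsto_intros lim_x lim_y lim_sum)
  moreover have "(N y)\<^sup>2 * (N x)\<^sup>2 + (N x)\<^sup>2 * (N y)\<^sup>2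
      - N y * N x * ((N x + N y)\<^sup>2 - (N x)\<^sup>2 - (N y)\<^sup>2) = 0"
    by (simp add: power2_eq_square algebra_simps)
  ultimately have "(\<lambda>n. (f n w)\<^sup>2) \<longlonglongrightarrow> 0"
    by simp
  then have "(\<lambda>n. sqrt ((f n w)\<^sup>2)) \<longlonglongrightarrow> sqrt 0"
    by (rule tendsto_real_sqrt)
  then have lim_w: "(\<lambda>n. f n w) \<longlonglongrightarrow> 0"
    by (simp add: f_def semi_inner_form.form_norm_nonneg[OF kform])
  have main: "N z \<le> N (z + \<xi> *\<^sub>C w)" if lim_z: "(\<lambda>n. f n z) \<longlonglongrightarrow> N z" for z
  proof (rule tendsto_upperbound)
    show "(\<lambda>n. f n z - cmod \<xi> * f n w) \<longlonglongrightarrow> N z"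
      using tendsto_diff[OF lim_z tendsto_mult[OF tendsto_const lim_w]] by simp
    have "f n z - cmod \<xi> * f n w \<le> N (z + \<xi> *\<^sub>C w)" for n
      using semi_inner_form.form_norm_add_ge[OF kform, of n z "\<xi> *\<^sub>C w"]
        semi_inner_form.form_norm_scale[OF kform, of n \<xi> w] f_le[of n "z + \<xi> *\<^sub>C w"]
      unfolding f_def by linarith
    then show "\<forall>\<^sub>F n in sequentially. f n z - cmod \<xi> * f n w \<le> N (z + \<xi> *\<^sub>C w)" by simp
  qed simp
  show "N x \<le> N (x + \<xi> *\<^sub>C (of_real (N y) *\<^sub>C x - of_real (N x) *\<^sub>C y))"
    using main[OF lim_x] unfolding w_def .
  show "N y \<le> N (y + \<xi> *\<^sub>C (of_real (N y) *\<^sub>C x - of_real (N x) *\<^sub>C y))"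
    using main[OF lim_y] unfolding w_def .
qed

section \<open>Positive functionals\<close>

lemma dual_space_add: "\<phi> \<in> dual_space \<Longrightarrow> \<phi> (x + y) = \<phi> x + \<phi> y"
  by (simp add: dual_space_def linear_add[OF bounded_linear.linear])

lemma dual_space_scaleC: "\<phi> \<in> dual_space \<Longrightarrow> \<phi> (c *\<^sub>C x) = c * \<phi> x"
  by (simp add: dual_space_def)

lemma semi_inner_form_functional:
  assumes "\<phi> \<in> dual_space" and "positive_functional \<phi>" and "positive_elem a"
  shows "semi_inner_form (\<lambda>u v. \<phi> (star u * a * v))"
proof
  fix x y z :: 'a and c :: complex
  show "\<phi> (star (x + y) * a * z) = \<phi> (star x * a * z) + \<phi> (star y * a * z)"
    by (simp add: star_add distrib_right dual_space_add[OF assms(1)])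
  show "\<phi> (star z * a * (x + y)) = \<phi> (star z * a * x) + \<phi> (star z * a * y)"
    by (simp add: distrib_left dual_space_add[OF assms(1)])
  show "\<phi> (star (c *\<^sub>C x) * a * y) = cnj c * \<phi> (star x * a * y)"
    by (simp add: star_scaleC mult_scaleC_left dual_space_scaleC[OF assms(1)])
  show "\<phi> (star x * a * (c *\<^sub>C y)) = c * \<phi> (star x * a * y)"
    by (simp add: mult_scaleC_right dual_space_scaleC[OF assms(1)])
  obtain b where "a = star b * b"
    using assms(3) by (auto simp: positive_elem_def)
  then have "star x * a * x = star (b * x) * (b * x)"
    by (simp add: star_mult mult.assoc)
  then have "positive_elem (star x * a * x)"
    unfolding positive_elem_def by blast
  then show "0 \<le> \<phi> (star x * a * x)"
    using assms(2) by (simp add: positive_functional_def)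
qed

lemma positive_elem_one: "positive_elem (1::'a::unital_cstar_algebra)"
  unfolding positive_elem_def by (rule exI[of _ 1]) (simp add: star_one)

text \<open>
  A state has norm at most 1 on self-adjoint elements. By the Cauchy-Schwarz inequality
  \<open>(cmod (\<psi> h))\<^sup>2 \<le> cmod (\<psi> (h * h))\<close>; iterating this and using only that \<open>\<psi>\<close> is bounded by some
  constant \<open>K\<close> gives \<open>cmod (\<psi> h) ^ 2 ^ n \<le> norm h ^ 2 ^ n * K\<close> for all \<open>n\<close>.
\<close>

lemma cmod_state_le_norm:
  fixes h :: "'a::unital_cstar_algebra"
  assumes "\<psi> \<in> states_wrt 1" and "star h = h"
  shows "cmod (\<psi> h) \<le> norm h"
proof (rule ccontr)
  assume "\<not> ?thesis"
  then have gt: "norm h < cmod (\<psi> h)" by simp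
  have dual: "\<psi> \<in> dual_space" and pos: "positive_functional \<psi>" and one: "\<psi> 1 = 1"
    using assms(1) by (auto simp: states_wrt_def)
  interpret semi_inner_form "\<lambda>u v. \<psi> (star u * 1 * v)"
    using semi_inner_form_functional[OF dual pos positive_elem_one] .
  have square: "(cmod (\<psi> g))\<^sup>2 \<le> cmod (\<psi> (g * g))" if "star g = g" for g
    using cauchy_schwarz[of 1 g] complex_Re_le_cmod[of "\<psi> (g * g)"] that
    by (simp add: star_one one)
  have self_adjoint: "star (h ^ m) = h ^ m" for m
    by (induction m) (simp_all add: star_one star_mult assms(2) power_commutes)
  have iterate: "cmod (\<psi> h) ^ 2 ^ n \<le> cmod (\<psi> (h ^ 2 ^ n))" for n
  proof (induction n)
    case (Suc n)
    have "cmod (\<psi> h) ^ 2 ^ Suc n = (cmod (\<psi> h) ^ 2 ^ n)\<^sup>2"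
      by (simp add: mult.commute flip: power_mult)
    also have "\<dots> \<le> (cmod (\<psi> (h ^ 2 ^ n)))\<^sup>2"
      using Suc by (intro power_mono) simp_all
    also have "\<dots> \<le> cmod (\<psi> (h ^ 2 ^ n * h ^ 2 ^ n))"
      by (rule square[OF self_adjoint])
    finally show ?case by (simp add: mult_2 flip: power_add)
  qed simp
  obtain K where K: "\<And>z. cmod (\<psi> z) \<le> norm z * K"
    using dual bounded_linear.nonneg_bounded[of \<psi>] by (auto simp: dual_space_def)
  have "norm h > 0"
    using gt K[of h] by (cases "h = 0") auto
  then have ratio: "1 < cmod (\<psi> h) / norm h"
    using gt by simp
  have "(cmod (\<psi> h) / norm h) ^ 2 ^ n \<le> K" for n
  proof -
    have "K \<ge> 0"
      using K[of 1] by (simp add: one)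
    then have "norm (h ^ 2 ^ n) * K \<le> norm h ^ 2 ^ n * K"
      by (intro mult_right_mono norm_power_ineq)
    then have "cmod (\<psi> h) ^ 2 ^ n \<le> norm h ^ 2 ^ n * K"
      using iterate[of n] K[of "h ^ 2 ^ n"] by linarith
    then show ?thesis
      using \<open>norm h > 0\<close> by (simp add: power_divide field_simps)
  qed
  moreover obtain m where "K < (cmod (\<psi> h) / norm h) ^ m"
    using real_arch_pow[OF ratio] by blast
  moreover have "(cmod (\<psi> h) / norm h) ^ m \<le> (cmod (\<psi> h) / norm h) ^ 2 ^ m"
    using ratio less_exp[of m] by (intro power_increasing) simp_all
  ultimately show False by (meson not_le order_trans)
qed

lemma state_conjugate:
  assumes "\<phi> \<in> states_wrt (star b * b)"
  shows "(\<lambda>w. \<phi> (star b * w * b)) \<in> states_wrt 1"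
proof -
  have dual: "\<phi> \<in> dual_space" and pos: "positive_functional \<phi>" and one: "\<phi> (star b * b) = 1"
    using assms by (auto simp: states_wrt_def)
  have "bounded_linear (\<lambda>w. \<phi> (star b * w * b))"
    using dual bounded_linear_compose[of \<phi>]
      bounded_linear_mult_const[OF bounded_linear_mult_right, of "star b" b]
    by (simp add: dual_space_def)
  then have "(\<lambda>w. \<phi> (star b * w * b)) \<in> dual_space"
    using dual by (simp add: dual_space_def mult_scaleC_left mult_scaleC_right)
  moreover have "positive_functional (\<lambda>w. \<phi> (star b * w * b))"
    unfolding positive_functional_def
    using semi_inner_form.nonneg[OF semi_inner_form_functional[OF dual pos]] by blast
  ultimately show ?thesis
    using one by (simp add: states_wrt_def)
qed

text \<open>
  Writing \<open>a = star b * b\<close> with \<open>c * b = 1\<close>, the element \<open>star x * a * x\<close> equals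
  \<open>star b * (star z * z) * b\<close> for \<open>z = b * x * c\<close>, so that \<open>norm (star z * z)\<close> bounds
  the values of all \<open>\<phi>\<close> at once.
\<close>

lemma states_wrt_bounded_uniformly:
  fixes a x :: "'a::unital_cstar_algebra"
  assumes "positive_elem a" and "invertible_elem a"
  obtains M where "\<And>\<phi>. \<phi> \<in> states_wrt a \<Longrightarrow> Re (\<phi> (star x * a * x)) \<le> M"
proof -
  obtain b where b: "a = star b * b"
    using assms(1) by (auto simp: positive_elem_def)
  obtain d where d: "d * a = 1"
    using assms(2) by (auto simp: invertible_elem_def)
  define c where "c = d * star b"
  have cb: "c * b = 1" using d by (simp add: c_def b mult.assoc)
  define z where "z = b * x * c"
  have "z * b = b * x"
    by (simp add: z_def mult.assoc cb)
  moreover have "star b * star z = star x * star b"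
    using \<open>z * b = b * x\<close> star_mult[of z b] star_mult[of b x] by simp
  ultimately have conj: "star x * a * x = star b * (star z * z) * b"
    by (metis b mult.assoc)
  have "Re (\<phi> (star x * a * x)) \<le> norm (star z * z)" if "\<phi> \<in> states_wrt a" for \<phi>
    using cmod_state_le_norm[OF state_conjugate, of \<phi> b "star z * z"] that
      complex_Re_le_cmod[of "\<phi> (star x * a * x)"]
    by (simp add: b[symmetric] conj star_mult star_star)
  then show thesis by (rule that)
qed

section \<open>The (a,t)-norm as a supremum of semi-inner product seminorms\<close>

text \<open>The semi-inner product whose seminorm is the term of \<open>al_norm a t\<close> belonging to \<open>\<phi>\<close>.\<close>

definition al_form ::
    "'a::unital_cstar_algebra \<Rightarrow> real \<Rightarrow> ('a \<Rightarrow> complex) \<Rightarrow> 'a \<Rightarrow> 'a \<Rightarrow> complex"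
  where "al_form a t \<phi> u v =
    of_real t * \<phi> (star u * a * v) + of_real (1 - t) * (cnj (\<phi> (a * u)) * \<phi> (a * v))"

lemma semi_inner_form_al_form:
  assumes "positive_elem a" and "0 \<le> t" and "t \<le> 1" and "\<phi> \<in> states_wrt a"
  shows "semi_inner_form (al_form a t \<phi>)"
proof -
  have dual: "\<phi> \<in> dual_space" and pos: "positive_functional \<phi>"
    using assms(4) by (auto simp: states_wrt_def)
  interpret B: semi_inner_form "\<lambda>u v. \<phi> (star u * a * v)"
    using semi_inner_form_functional[OF dual pos assms(1)] .
  show ?thesis
  proof
    fix x y z :: 'a and c :: complex
    have add: "\<phi> (a * (x + y)) = \<phi> (a * x) + \<phi> (a * y)"
      by (simp add: distrib_left dual_space_add[OF dual])
    have scale: "\<phi> (a * (c *\<^sub>C u)) = c * \<phi> (a * u)" for u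
      by (simp add: mult_scaleC_right dual_space_scaleC[OF dual])
    show "al_form a t \<phi> (x + y) z = al_form a t \<phi> x z + al_form a t \<phi> y z"
      unfolding al_form_def B.add_left add by (simp add: algebra_simps)
    show "al_form a t \<phi> z (x + y) = al_form a t \<phi> z x + al_form a t \<phi> z y"
      unfolding al_form_def B.add_right add by (simp add: algebra_simps)
    show "al_form a t \<phi> (c *\<^sub>C x) y = cnj c * al_form a t \<phi> x y"
      unfolding al_form_def B.scale_left scale by (simp add: algebra_simps)
    show "al_form a t \<phi> x (c *\<^sub>C y) = c * al_form a t \<phi> x y"
      unfolding al_form_def B.scale_right scale by (simp add: algebra_simps)
    show "0 \<le> al_form a t \<phi> x x"
      using assms(2,3) B.Re_nonneg[of x] B.Im_zero[of x]
      by (simp add: al_form_def less_eq_complex_def)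
  qed
qed

lemma Re_al_form:
  "Re (al_form a t \<phi> x x) = t * Re (\<phi> (star x * a * x)) + (1 - t) * (cmod (\<phi> (a * x)))\<^sup>2"
  unfolding al_form_def cmod_power2 by (simp add: power2_eq_square algebra_simps)

lemma al_norm_eq_SUP: "al_norm a t x = (SUP \<phi>\<in>states_wrt a. form_norm (al_form a t \<phi>) x)"
  by (simp add: al_norm_def form_norm_def Re_al_form)

lemma bdd_above_al_form:
  assumes "positive_elem a" and "invertible_elem a" and "0 \<le> t" and "t \<le> 1"
  shows "bdd_above ((\<lambda>\<phi>. form_norm (al_form a t \<phi>) x) ` states_wrt a)"
proof -
  obtain M where M: "\<And>\<phi>. \<phi> \<in> states_wrt a \<Longrightarrow> Re (\<phi> (star x * a * x)) \<le> M"
    using states_wrt_bounded_uniformly[OF assms(1,2)] by blast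
  have "form_norm (al_form a t \<phi>) x \<le> sqrt M" if \<phi>: "\<phi> \<in> states_wrt a" for \<phi>
  proof -
    have dual: "\<phi> \<in> dual_space" and pos: "positive_functional \<phi>" and one: "\<phi> a = 1"
      using \<phi> by (auto simp: states_wrt_def)
    interpret B: semi_inner_form "\<lambda>u v. \<phi> (star u * a * v)"
      using semi_inner_form_functional[OF dual pos assms(1)] .
    have "(cmod (\<phi> (a * x)))\<^sup>2 \<le> Re (\<phi> (star x * a * x))"
      using B.cauchy_schwarz[of 1 x] by (simp add: star_one one)
    then have "Re (al_form a t \<phi> x x) \<le> t * M + (1 - t) * M"
      unfolding Re_al_form using M[OF \<phi>] assms(3,4)
      by (intro add_mono mult_left_mono) simp_all
    then show ?thesis by (simp add: form_norm_def algebra_simps)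
  qed
  then show ?thesis by (rule bdd_aboveI2)
qed

lemma al_norm_unimodular:
  assumes "positive_elem a" and "0 \<le> t" and "t \<le> 1" and "cmod \<mu> = 1"
  shows "al_norm a t (\<mu> *\<^sub>C x) = al_norm a t x"
  unfolding al_norm_eq_SUP
  using semi_inner_form.form_norm_scale[OF semi_inner_form_al_form[OF assms(1-3)], of _ \<mu> x]
  by (intro SUP_cong) (simp_all add: assms(4))

theorem theorem4p6:
  fixes a x y :: "'a::unital_cstar_algebra" and t :: real
  assumes "positive_elem a" and "invertible_elem a"
    and "0 \<le> t" and "t \<le> 1"
    and "al_parallel a t x y"
  shows "(\<exists>\<mu>::complex. cmod \<mu> = 1 \<and>
            al_orthogonal a t x
              (complex_of_real (al_norm a t y) *\<^sub>C x - (\<mu> * complex_of_real (al_norm a t x)) *\<^sub>C y)) \<and>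
         (\<exists>\<mu>::complex. cmod \<mu> = 1 \<and>
            al_orthogonal a t y
              (complex_of_real (al_norm a t y) *\<^sub>C x - (cnj \<mu> * complex_of_real (al_norm a t x)) *\<^sub>C y))"
proof -
  let ?N = "al_norm a t"
  obtain \<mu> where \<mu>: "cmod \<mu> = 1" and par: "?N (x + \<mu> *\<^sub>C y) = ?N x + ?N y"
    using assms(5) by (auto simp: al_parallel_def)
  note unimod = al_norm_unimodular[OF assms(1,3,4) \<mu>]
  let ?w = "complex_of_real (?N y) *\<^sub>C x - (\<mu> * complex_of_real (?N x)) *\<^sub>C y"
  have w: "?w = of_real (?N (\<mu> *\<^sub>C y)) *\<^sub>C x - of_real (?N x) *\<^sub>C (\<mu> *\<^sub>C y)"
    by (simp add: unimod scaleC_scaleC mult.commute)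
  have "al_orthogonal a t x ?w \<and> al_orthogonal a t y ?w"
  proof (cases "states_wrt a = {}")
    case True
    \<comment> \<open>The supremum over the empty set does not depend on the vector.\<close>
    then show ?thesis by (simp add: al_orthogonal_def al_norm_def)
  next
    case False
    have orth: "?N x \<le> ?N (x + \<xi> *\<^sub>C ?w)" "?N (\<mu> *\<^sub>C y) \<le> ?N (\<mu> *\<^sub>C y + \<xi> *\<^sub>C ?w)" for \<xi>
      using sup_form_norm_orthogonal[of "states_wrt a" "al_form a t" x "\<mu> *\<^sub>C y" \<xi>]
        semi_inner_form_al_form[OF assms(1,3,4)] False bdd_above_al_form[OF assms(1-4)]
        par unimod[of y]
      unfolding w by (simp_all flip: al_norm_eq_SUP)
    have "?N y \<le> ?N (y + \<xi> *\<^sub>C ?w)" for \<xi>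
      using orth(2)[of "\<mu> * \<xi>"] unimod[of y] unimod[of "y + \<xi> *\<^sub>C ?w"]
      by (simp add: scaleC_add_right scaleC_scaleC)
    then show ?thesis using orth(1) by (simp add: al_orthogonal_def)
  qed
  moreover have "cmod (cnj \<mu>) = 1" "cnj (cnj \<mu>) = \<mu>" using \<mu> by simp_all
  ultimately show ?thesis using \<mu> by metis
qed

end
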